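(* Let $\{(\mathcal V_i, v_i)\}_{i=1}^m$ and $\{(\mathcal W_i, w_i)\}_{i=1}^m$ be two weaving fusion frames for the $n$-dimensional Hilbert space $\mathcal H^n$. Then the following are equivalent: (1) $\{(\mathcal V_i, v_i)\}_{i=1}^m$ and $\{(\mathcal W_i, w_i)\}_{i=1}^m$ are phase retrievable weaving fusion frames for $\mathcal H^n$. (2) $\operatorname{Ker} \mathcal F_\sigma \cap S^{1,1}(\mathcal H^n)=\{0\}$ for every $\sigma \subset \{1, 2, \dots , m\}$.
   Context: $\mathcal H^n$ is an $n$-dimensional (real or complex) Hilbert space. For a closed subspace $\mathcal V$, $P_{\mathcal V}$ is the orthogonal projection onto $\mathcal V$. A weighted collection $\{(\mathcal W_i,w_i)\}_{i=1}^m$ consists of closed subspaces $\mathcal W_i$ of $\mathcal H^n$ and real scalars $w_i$; it is a fusion frame for $\mathcal H^n$ if there are constants $0<A\le B<\infty$ with $A\|f\|^2\le \sum_{i=1}^m w_i^2\|P_{\mathcal W_i}f\|^2\le B\|f\|^2$ for all $f\in\mathcal H^n$. Two fusion frames $\{(\mathcal V_i,v_i)\}_{i=1}^m$ and $\{(\mathcal W_i,w_i)\}_{i=1}^m$ are called weaving fusion frames for $\mathcal H^n$ if there are universal constants $0<A\le B<\infty$ such that for every $\sigma\subset\{1,\dots,m\}$ (with $\sigma^c$ its complement in $\{1,\dots,m\}$) and every $f\in\mathcal H^n$, $$A\|f\|^2\le \sum_{i\in\sigma} v_i^2\|P_{\mathcal V_i}f\|^2+\sum_{i\in\sigma^c}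 w_i^2\|P_{\mathcal W_i}f\|^2\le B\|f\|^2 .$$ Write $f\sim g$ if $g=hf$ for some scalar $h$ with $|h|=1$ (so $h=\pm1$ in the real case), and let $\hat f$ be the class of $f$ in $\hat{\mathcal H^n}=\mathcal H^n/\sim$. For $\sigma\subset\{1,\dots,m\}$ define $\gamma_\sigma:\hat{\mathcal H^n}\to\mathbb R^m$ by $(\gamma_\sigma(\hat f))_i=v_i\|P_{\mathcal V_i}f\|$ if $i\in\sigma$ and $(\gamma_\sigma(\hat f))_i=w_i\|P_{\mathcal W_i}f\|$ if $i\in\sigma^c$. The weaving fusion frames $\{(\mathcal V_i,v_i)\}_{i=1}^m$ and $\{(\mathcal W_i,w_i)\}_{i=1}^m$ are called phase retrievable weaving fusion frames if $\gamma_\sigma$ is injective for every $\sigma\subset\{1,\dots,m\}$. $\mathrm{Sym}(\mathcal H^n)$ is the set of symmetric (self-adjoint) operators on $\mathcal H^n$, and $S^{1,1}(\mathcal H^n)=\{T\in \mathrm{Sym}(\mathcal H^n): \dim R(T)\le 2\}$, where $R(T)$ is the range of $T$. For $\sigma\subset\{1,\dots,m\}$, the weaving phase lift operator $\mathcal F_\sigma:\mathrm{Sym}(\mathcal H^n)\to\mathbb R^m$ is defined by $(\mathcal F_\sigma T)_i=v_i^2\operatorname{tr}(P_{\mathcal V_i}T)$ if $i\in\sigma$ and $(\mathcal F_\sigma T)_i=w_i^2\operatorname{tr}(P_{\mathcal W_i}T)$ if $i\in\sigma^c$. *)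

theory Defs
  imports "HOL-Analysis.Analysis"
begin

section \<open>Scalars: the real or the complex numbers\<close>

text \<open>The class is instantiated by \<open>real\<close> and \<open>complex\<close>, and
  lemma \<open>real_or_complex_cases\<close> shows that, up to isomorphism, it has no other instances.\<close>

class real_or_complex = real_normed_field +
  fixes sc_cnj :: "'a \<Rightarrow> 'a"
    and sc_re :: "'a \<Rightarrow> real"
  assumes sc_cnj_add: "sc_cnj (x + y) = sc_cnj x + sc_cnj y"
    and sc_cnj_mult: "sc_cnj (x * y) = sc_cnj x * sc_cnj y"
    and sc_cnj_cnj: "sc_cnj (sc_cnj x) = x"
    and mult_sc_cnj_scaleR: "x * sc_cnj x = (norm x)\<^sup>2 *\<^sub>R 1"
    and add_sc_cnj_scaleR: "x + sc_cnj x = (2 * sc_re x) *\<^sub>R 1"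

lemma mult_sc_cnj: "x * sc_cnj x = of_real ((norm x)\<^sup>2)"
  by (simp add: mult_sc_cnj_scaleR of_real_def)

lemma of_real_sc_re: "of_real (sc_re x) = (x + sc_cnj x) / 2"
  by (simp add: add_sc_cnj_scaleR flip: of_real_def)

instantiation real :: real_or_complex
begin
definition sc_cnj_real :: "real \<Rightarrow> real" where "sc_cnj_real x = x"
definition sc_re_real :: "real \<Rightarrow> real" where "sc_re_real x = x"
instance
  by standard (simp_all add: sc_cnj_real_def sc_re_real_def power2_eq_square)
end

instantiation complex :: real_or_complex
begin
definition sc_cnj_complex :: "complex \<Rightarrow> complex" where "sc_cnj_complex z = cnj z"
definition sc_re_complex :: "complex \<Rightarrow> real" where "sc_re_complex z = Re z"
instance
  by standard
    (simp_all add: sc_cnj_complex_def sc_re_complex_def complex_mult_cnj cmod_power2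
      complex_add_cnj scaleR_conv_of_real)
end

lemma real_or_complex_cases:
  obtains (real) "\<And>z::'k::real_or_complex. z \<in> \<real>"
  | (complex) j :: "'k::real_or_complex" where "j * j = -1"
      "\<And>z::'k. \<exists>!ab. z = of_real (fst ab) + of_real (snd ab) * j"
proof (cases "\<forall>z::'k. z \<in> \<real>")
  case True
  then show thesis using real by blast
next
  case False
  then obtain z0 :: 'k where z0: "z0 \<notin> \<real>" by blast
  have cnj0: "sc_cnj (0::'k) = 0"
    using sc_cnj_add[of "0::'k" 0] by simp
  have cnjm: "sc_cnj (- x) = - sc_cnj x" for x :: 'k
  proof -
    have "sc_cnj x + sc_cnj (- x) = 0"
      using sc_cnj_add[of x "- x"] cnj0 by simp
    then show ?thesis by (rule minus_unique[symmetric])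
  qed
  have fixed: "z \<in> \<real>" if "sc_cnj z = z" for z :: 'k
  proof -
    have "z = of_real (sc_re z)" using that by (simp add: of_real_sc_re)
    then show ?thesis by (metis Reals_of_real)
  qed
  have anti: "sc_cnj (z - of_real (sc_re z)) = - (z - of_real (sc_re z))" for z :: 'k
  proof -
    have a: "z - of_real (sc_re z) = (z - sc_cnj z) / 2"
      by (simp add: of_real_sc_re field_simps)
    have one: "sc_cnj (1::'k) = 1"
      using mult_sc_cnj[of "1::'k"] by simp
    have two: "sc_cnj (1/2::'k) = 1/2"
    proof -
      have "sc_cnj (1/2::'k) + sc_cnj (1/2::'k) = 1"
        using sc_cnj_add[of "1/2::'k" "1/2"] one by simp
      then show ?thesis by (simp add: field_simps)
    qed
    have "sc_cnj ((z - sc_cnj z) * (1/2)) = (sc_cnj z - z) * (1/2)"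
      using sc_cnj_add[of z "- sc_cnj z"]
      by (simp only: sc_cnj_mult two) (simp add: cnjm sc_cnj_cnj)
    then show ?thesis unfolding a by (simp add: field_simps)
  qed
  define w where "w = z0 - of_real (sc_re z0)"
  have w0: "w \<noteq> 0"
  proof
    assume "w = 0"
    then have "z0 = of_real (sc_re z0)" by (simp add: w_def)
    then show False using z0 by (metis Reals_of_real)
  qed
  have cw: "sc_cnj w = - w" unfolding w_def by (rule anti)
  have ww: "w * w = - of_real ((norm w)\<^sup>2)"
    using mult_sc_cnj[of w] unfolding cw by (metis minus_minus mult_minus_right)
  define j where "j = w / of_real (norm w)"
  have jj: "j * j = -1"
    unfolding j_def using w0 ww by (simp add: power2_eq_square field_simps)
  have j0: "j \<noteq> 0" using jj by auto
  have imag: "y / w \<in> \<real>" if "sc_cnj y = - y" for y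
  proof (rule fixed)
    have "sc_cnj (y / w) * sc_cnj w = sc_cnj y"
      using w0 by (simp flip: sc_cnj_mult)
    then show "sc_cnj (y / w) = y / w"
      using w0 by (simp add: cw that field_simps)
  qed
  have jnr: "j \<notin> \<real>"
  proof
    assume "j \<in> \<real>"
    then obtain r where "j = of_real r" by (auto elim: Reals_cases)
    then have "of_real (r * r) = (of_real (-1) :: 'k)" using jj by simp
    then have "r * r = -1" by (simp only: of_real_eq_iff)
    then show False using zero_le_square[of r] by linarith
  qed
  have "\<exists>!ab. z = of_real (fst ab) + of_real (snd ab) * j" for z :: 'k
  proof -
    obtain t where t: "(z - of_real (sc_re z)) / w = of_real t"
      using imag[OF anti[of z]] by (auto elim: Reals_cases)
    then have "z = of_real (sc_re z) + of_real (t * norm w) * j"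
      using w0 by (simp add: j_def field_simps)
    then have ex: "\<exists>ab. z = of_real (fst ab) + of_real (snd ab) * j"
      by (intro exI[of _ "(sc_re z, t * norm w)"]) simp
    have "a = c \<and> b = d" if "of_real a + of_real b * j = of_real c + of_real d * j" for a b c d
    proof -
      have e: "of_real (b - d) * j = of_real (c - a)"
        using that by (simp add: algebra_simps)
      have "b = d"
      proof (rule ccontr)
        assume "b \<noteq> d"
        then have "j = of_real (c - a) / of_real (b - d)"
          using e by (simp add: field_simps)
        then have "j = of_real ((c - a) / (b - d))" by simp
        then show False using jnr by (metis Reals_of_real)
      qed
      then show ?thesis using e by simp
    qed
    with ex show ?thesis by (metis prod.collapse)
  qed
  with jj show thesis by (rule complex)
qed

section \<open>Finite-dimensional Hilbert spaces\<close>

text \<open>The inner product is linear in its first argument. Completeness needs no axiom, as every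
  finite-dimensional inner product space over the reals or the complex numbers is complete; for the
  same reason a closed subspace is just a linear subspace.\<close>

locale fd_hilbert_space = vector_space scale
  for scale :: "'k::real_or_complex \<Rightarrow> 'v::ab_group_add \<Rightarrow> 'v" +
  fixes ip :: "'v \<Rightarrow> 'v \<Rightarrow> 'k"
    and n :: nat
  assumes ip_add_left: "ip (x + y) z = ip x z + ip y z"
    and ip_scale_left: "ip (scale a x) y = a * ip x y"
    and ip_commute: "ip y x = sc_cnj (ip x y)"
    and ip_self_pos: "x \<noteq> 0 \<Longrightarrow> sc_re (ip x x) > 0"
    and dimension: "\<exists>B. finite B \<and> card B = n \<and> independent B \<and> span B = UNIV"
begin

definition hnorm :: "'v \<Rightarrow> real" where
  "hnorm f = sqrt (sc_re (ip f f))"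

definition proj :: "'v set \<Rightarrow> 'v \<Rightarrow> 'v" where
  "proj U f = (THE p. p \<in> U \<and> (\<forall>u\<in>U. ip (f - p) u = 0))"

definition orthonormal_basis :: "'v set \<Rightarrow> bool" where
  "orthonormal_basis B \<longleftrightarrow>
     finite B \<and> span B = UNIV \<and> (\<forall>b\<in>B. \<forall>c\<in>B. ip b c = (if b = c then 1 else 0))"

text \<open>The trace does not depend on the choice of the orthonormal basis.\<close>

definition trace :: "('v \<Rightarrow> 'v) \<Rightarrow> 'k" where
  "trace T = (let B = (SOME B. orthonormal_basis B) in \<Sum>b\<in>B. ip (T b) b)"

subsection \<open>Fusion frames and weaving\<close>

definition fusion_frame :: "nat \<Rightarrow> (nat \<Rightarrow> 'v set) \<Rightarrow> (nat \<Rightarrow> real) \<Rightarrow> bool" where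
  "fusion_frame m W w \<longleftrightarrow>
     (\<forall>i\<in>{1..m}. subspace (W i)) \<and>
     (\<exists>A B. 0 < A \<and> A \<le> B \<and>
        (\<forall>f. A * (hnorm f)\<^sup>2 \<le> (\<Sum>i\<in>{1..m}. (w i)\<^sup>2 * (hnorm (proj (W i) f))\<^sup>2) \<and>
             (\<Sum>i\<in>{1..m}. (w i)\<^sup>2 * (hnorm (proj (W i) f))\<^sup>2) \<le> B * (hnorm f)\<^sup>2))"

definition weaving_sum ::
  "nat \<Rightarrow> (nat \<Rightarrow> 'v set) \<Rightarrow> (nat \<Rightarrow> real) \<Rightarrow> (nat \<Rightarrow> 'v set) \<Rightarrow> (nat \<Rightarrow> real) \<Rightarrow> nat set \<Rightarrow> 'v \<Rightarrow> real"
  where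
  "weaving_sum m V v W w \<sigma> f =
     (\<Sum>i\<in>\<sigma>. (v i)\<^sup>2 * (hnorm (proj (V i) f))\<^sup>2) +
     (\<Sum>i\<in>{1..m} - \<sigma>. (w i)\<^sup>2 * (hnorm (proj (W i) f))\<^sup>2)"

definition weaving_fusion_frames ::
  "nat \<Rightarrow> (nat \<Rightarrow> 'v set) \<Rightarrow> (nat \<Rightarrow> real) \<Rightarrow> (nat \<Rightarrow> 'v set) \<Rightarrow> (nat \<Rightarrow> real) \<Rightarrow> bool" where
  "weaving_fusion_frames m V v W w \<longleftrightarrow>
     fusion_frame m V v \<and> fusion_frame m W w \<and>
     (\<exists>A B. 0 < A \<and> A \<le> B \<and>
        (\<forall>\<sigma>. \<sigma> \<subseteq> {1..m} \<longrightarrow>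
          (\<forall>f. A * (hnorm f)\<^sup>2 \<le> weaving_sum m V v W w \<sigma> f \<and>
               weaving_sum m V v W w \<sigma> f \<le> B * (hnorm f)\<^sup>2)))"

subsection \<open>Phase retrieval\<close>

definition phase_rel :: "('v \<times> 'v) set" where
  "phase_rel = {(f, g). \<exists>h. norm h = 1 \<and> g = scale h f}"

definition phase_space :: "'v set set" where
  "phase_space = UNIV // phase_rel"

text \<open>Points of \<open>\<real>\<^sup>m\<close> are functions on \<open>{1..m}\<close>, made \<open>undefined\<close> elsewhere by \<open>restrict\<close>.
  The measurements take a single value on each phase class, which is what \<open>the_elem\<close> selects.\<close>

definition weaving_measurement ::
  "nat \<Rightarrow> (nat \<Rightarrow> 'v set) \<Rightarrow> (nat \<Rightarrow> real) \<Rightarrow> (nat \<Rightarrow> 'v set) \<Rightarrow> (nat \<Rightarrow> real) \<Rightarrow> nat set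
     \<Rightarrow> 'v set \<Rightarrow> (nat \<Rightarrow> real)" where
  "weaving_measurement m V v W w \<sigma> c =
     (\<lambda>i\<in>{1..m}. the_elem
        ((\<lambda>f. if i \<in> \<sigma> then v i * hnorm (proj (V i) f) else w i * hnorm (proj (W i) f)) ` c))"

definition phase_retrievable_weaving ::
  "nat \<Rightarrow> (nat \<Rightarrow> 'v set) \<Rightarrow> (nat \<Rightarrow> real) \<Rightarrow> (nat \<Rightarrow> 'v set) \<Rightarrow> (nat \<Rightarrow> real) \<Rightarrow> bool" where
  "phase_retrievable_weaving m V v W w \<longleftrightarrow>
     weaving_fusion_frames m V v W w \<and>
     (\<forall>\<sigma>. \<sigma> \<subseteq> {1..m} \<longrightarrow> inj_on (weaving_measurement m V v W w \<sigma>) phase_space)"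

subsection \<open>The weaving phase lift operator\<close>

definition Sym :: "('v \<Rightarrow> 'v) set" where
  "Sym = {T. Vector_Spaces.linear scale scale T \<and> (\<forall>x y. ip (T x) y = ip x (T y))}"

definition S11 :: "('v \<Rightarrow> 'v) set" where
  "S11 = {T \<in> Sym. dim (range T) \<le> 2}"

text \<open>The trace of the product of two self-adjoint operators is real; \<open>sc_re\<close> only moves this
  scalar to type \<open>real\<close>.\<close>

definition phase_lift ::
  "nat \<Rightarrow> (nat \<Rightarrow> 'v set) \<Rightarrow> (nat \<Rightarrow> real) \<Rightarrow> (nat \<Rightarrow> 'v set) \<Rightarrow> (nat \<Rightarrow> real) \<Rightarrow> nat set
     \<Rightarrow> ('v \<Rightarrow> 'v) \<Rightarrow> (nat \<Rightarrow> real)" where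
  "phase_lift m V v W w \<sigma> T =
     (\<lambda>i\<in>{1..m}. if i \<in> \<sigma> then (v i)\<^sup>2 * sc_re (trace (proj (V i) \<circ> T))
                 else (w i)\<^sup>2 * sc_re (trace (proj (W i) \<circ> T)))"

definition phase_lift_ker ::
  "nat \<Rightarrow> (nat \<Rightarrow> 'v set) \<Rightarrow> (nat \<Rightarrow> real) \<Rightarrow> (nat \<Rightarrow> 'v set) \<Rightarrow> (nat \<Rightarrow> real) \<Rightarrow> nat set
     \<Rightarrow> ('v \<Rightarrow> 'v) set" where
  "phase_lift_ker m V v W w \<sigma> = {T \<in> Sym. phase_lift m V v W w \<sigma> T = (\<lambda>i\<in>{1..m}. 0)}"

end

lemma fd_hilbert_space_euclidean:
  "fd_hilbert_space (scaleR :: real \<Rightarrow> 'a \<Rightarrow> 'a::euclidean_space) (\<bullet>) DIM('a)"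
proof -
  have b: "\<exists>B::'a set. finite B \<and> card B = DIM('a) \<and> independent B \<and> span B = UNIV"
    by (rule exI[of _ Basis]) (simp add: independent_Basis span_Basis)
  show ?thesis
    by (rule fd_hilbert_space.intro[OF real_vector.vector_space_axioms],
        unfold_locales)
      (use b in \<open>simp_all add: inner_simps inner_commute sc_cnj_real_def sc_re_real_def
          dependent_raw_def span_raw_def\<close>)
qed

lemma fd_hilbert_space_complex:
  "fd_hilbert_space ((*s) :: complex \<Rightarrow> complex^'d \<Rightarrow> complex^'d)
     (\<lambda>x y. \<Sum>i\<in>UNIV. x $ i * cnj (y $ i)) CARD('d)"
proof -
  have b: "\<exists>B::(complex^'d) set. finite B \<and> card B = CARD('d) \<and> vec.independent B \<and> vec.span B = UNIV"
    by (rule exI[of _ cart_basis])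
      (simp add: finite_cart_basis card_cart_basis independent_cart_basis span_cart_basis)
  have pos: "0 < Re (\<Sum>i\<in>UNIV. x $ i * cnj (x $ i))" if nz: "x \<noteq> 0" for x :: "complex^'d"
  proof -
    obtain i where i: "x $ i \<noteq> 0" using nz by (metis vec_eq_iff zero_index)
    have "(0::real) < (\<Sum>i\<in>UNIV. (norm (x $ i))\<^sup>2)"
      by (rule sum_pos2[of _ i]) (use i in auto)
    also have "\<dots> = Re (\<Sum>i\<in>UNIV. x $ i * cnj (x $ i))"
      by (simp add: complex_norm_square[symmetric] del: of_real_power)
    finally show ?thesis .
  qed
  show ?thesis
    by (rule fd_hilbert_space.intro[OF vec.vector_space_axioms], unfold_locales)
      (use b pos in \<open>simp_all add: sc_cnj_complex_def sc_re_complex_def sum.distrib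
          sum_distrib_left algebra_simps\<close>)
qed

end

theory Submission
  imports Defs
begin

text \<open>A self-adjoint operator of rank at most two is \<open>T = a f f\<^sup>* + b g g\<^sup>*\<close> with real \<open>a\<close>, \<open>b\<close>:
  if \<open>T \<noteq> 0\<close>, then \<open>\<langle>T x, x\<rangle> \<noteq> 0\<close> for some \<open>x\<close>, and subtracting \<open>(T x)(T x)\<^sup>* / \<langle>T x, x\<rangle>\<close>
  lowers the rank, so the spectral theorem is not needed. Since \<open>tr (P f f\<^sup>*) = \<parallel>P f\<parallel>\<^sup>2\<close>, membership in the kernel
  says that the squared measurements satisfy \<open>a (\<gamma> f)\<^sub>i\<^sup>2 + b (\<gamma> g)\<^sub>i\<^sup>2 = 0\<close> for every \<open>i\<close>. For
  coefficients of opposite signs this is equality of the measurements of \<open>\<surd>a f\<close> and \<open>\<surd>(-b) g\<close>,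
  hence a matter of phase retrieval; for equal signs the lower frame bound gives \<open>T = 0\<close>.\<close>

section \<open>Conjugation and real part on real scalars\<close>

lemma sc_cnj_of_real [simp]: "sc_cnj (of_real r :: 'k::real_or_complex) = of_real r"
proof (cases "r = 0")
  case True
  then show ?thesis using sc_cnj_add[of "0::'k" 0] by simp
next
  case False
  \<comment> \<open>Cancelling \<open>of_real r\<close> from the norm identity is what forces the
    separate case \<open>r = 0\<close>.\<close>
  have "(of_real r :: 'k) * sc_cnj (of_real r) = of_real r * of_real r"
    using mult_sc_cnj[of "of_real r :: 'k"] by (simp add: power2_eq_square flip: of_real_mult)
  with False show ?thesis by simp
qed

lemma sc_cnj_0 [simp]: "sc_cnj (0::'k::real_or_complex) = 0"
  using sc_cnj_of_real[of 0] by simp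

lemma sc_re_of_real [simp]: "sc_re (of_real r :: 'k::real_or_complex) = r"
proof -
  have "(of_real (sc_re (of_real r :: 'k)) :: 'k) = of_real r"
    by (simp add: of_real_sc_re)
  then show ?thesis by (simp only: of_real_eq_iff)
qed

lemma sc_re_0 [simp]: "sc_re (0::'k::real_or_complex) = 0"
  using sc_re_of_real[of 0] by simp

lemma sc_cnj_fixed: "sc_cnj x = x \<Longrightarrow> x = of_real (sc_re (x::'k::real_or_complex))"
  by (simp add: of_real_sc_re)

context fd_hilbert_space
begin

section \<open>Inner product and norm\<close>

lemma ip_add_right: "ip x (y + z) = ip x y + ip x z"
  by (metis ip_add_left ip_commute sc_cnj_add)

lemma ip_scale_right: "ip x (scale a y) = sc_cnj a * ip x y"
  by (metis ip_scale_left ip_commute sc_cnj_mult)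

lemma ip_0_left [simp]: "ip 0 x = 0"
  using ip_add_left[of 0 0 x] by simp

lemma ip_0_right [simp]: "ip x 0 = 0"
  using ip_add_right[of x 0 0] by simp

lemma ip_minus_left: "ip (- x) y = - ip x y"
  using ip_add_left[of x "- x" y] by (simp add: eq_neg_iff_add_eq_0 add.commute)

lemma ip_diff_left: "ip (x - y) z = ip x z - ip y z"
  using ip_add_left[of x "- y" z] by (simp add: ip_minus_left)

lemma ip_sum_left: "ip (\<Sum>a\<in>A. F a) x = (\<Sum>a\<in>A. ip (F a) x)"
  by (induction A rule: infinite_finite_induct) (simp_all add: ip_add_left)

lemma ip_self_nonneg: "sc_re (ip x x) \<ge> 0"
  using ip_self_pos[of x] by (cases "x = 0") auto

text \<open>Hermitian symmetry makes \<open>ip x x\<close> a fixed point of conjugation, hence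
  real.\<close>

lemma ip_self: "ip x x = of_real ((hnorm x)\<^sup>2)"
  using sc_cnj_fixed[OF ip_commute[of x x, symmetric]] ip_self_nonneg[of x]
  by (simp add: hnorm_def)

lemma ip_self_eq_0_iff [simp]: "ip x x = 0 \<longleftrightarrow> x = 0"
  using ip_self_pos[of x] by (cases "x = 0") auto

lemma hnorm_nonneg: "hnorm x \<ge> 0"
  by (simp add: hnorm_def ip_self_nonneg)

lemma hnorm_eq_0_iff [simp]: "hnorm x = 0 \<longleftrightarrow> x = 0"
  using ip_self_eq_0_iff[of x] by (simp add: ip_self)

lemma hnorm_scale: "hnorm (scale a x) = norm a * hnorm x"
proof -
  have "(of_real ((hnorm (scale a x))\<^sup>2) :: 'k) = (a * sc_cnj a) * ip x x"
    unfolding ip_self[symmetric] by (simp add: ip_scale_left ip_scale_right)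
  also have "\<dots> = of_real ((norm a * hnorm x)\<^sup>2)"
    by (simp add: mult_sc_cnj ip_self power_mult_distrib)
  finally have "(hnorm (scale a x))\<^sup>2 = (norm a * hnorm x)\<^sup>2" by (simp only: of_real_eq_iff)
  then show ?thesis by (simp add: hnorm_nonneg)
qed

subsection \<open>Orthonormal sets and projections\<close>

definition orthonormal :: "'v set \<Rightarrow> bool" where
  "orthonormal B \<longleftrightarrow> finite B \<and> (\<forall>b\<in>B. \<forall>c\<in>B. ip b c = (if b = c then 1 else 0))"

text \<open>For orthonormal \<open>B\<close> this is the orthogonal projection onto
  \<open>span B\<close>.\<close>

definition expansion :: "'v set \<Rightarrow> 'v \<Rightarrow> 'v" where
  "expansion B x = (\<Sum>b\<in>B. scale (ip x b) b)"

lemma expansion_in_span: "expansion B x \<in> span B"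
  unfolding expansion_def by (intro span_sum span_scale span_base)

lemma ip_span_eq_0:
  assumes "\<And>b. b \<in> B \<Longrightarrow> ip x b = 0" and "u \<in> span B"
  shows "ip x u = 0"
  using assms(2)
  by (induction rule: span_induct_alt) (simp_all add: ip_add_right ip_scale_right assms(1))

lemma ip_expansion_residual:
  assumes "orthonormal B" and "u \<in> span B"
  shows "ip (x - expansion B x) u = 0"
proof (rule ip_span_eq_0[OF _ assms(2)])
  fix c assume c: "c \<in> B"
  have "ip (expansion B x) c = (\<Sum>b\<in>B. if b = c then ip x b else 0)"
    unfolding expansion_def ip_sum_left
    by (rule sum.cong) (use assms(1) c in \<open>auto simp: orthonormal_def ip_scale_left\<close>)
  also have "\<dots> = ip x c" using assms(1) c by (simp add: orthonormal_def)
  finally show "ip (x - expansion B x) c = 0" by (simp add: ip_diff_left)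
qed

text \<open>The residual lies in \<open>span B\<close> and is orthogonal to it, hence to
  itself.\<close>

lemma expansion_eq:
  assumes "orthonormal B" and "x \<in> span B"
  shows "expansion B x = x"
  using ip_expansion_residual[OF assms(1), of "x - expansion B x" x]
    span_diff[OF assms(2) expansion_in_span] by simp

text \<open>Gram-Schmidt, one vector of \<open>S\<close> at a time; a vector with zero residual is
  dropped.\<close>

lemma ex_orthonormal_span:
  assumes "finite S"
  shows "\<exists>B. orthonormal B \<and> span B = span S"
  using assms
proof induction
  case empty
  show ?case by (rule exI[of _ "{}"]) (simp add: orthonormal_def)
next
  case (insert a S)
  then obtain B where B: "orthonormal B" "span B = span S" by blast
  define r where "r = a - expansion B a"
  have e: "expansion B a \<in> span B" by (rule expansion_in_span)
  have span_a: "span (insert a S) = span (insert a B)"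
    using B(2) by (auto simp: span_insert)
  show ?case
  proof (cases "r = 0")
    case True
    then have "a \<in> span B" using e by (simp add: r_def)
    then have "span (insert a B) = span B" by (rule span_redundant)
    with B(1) span_a show ?thesis by auto
  next
    case False
    define c :: 'k where "c = of_real (inverse (hnorm r))"
    have c0: "c \<noteq> 0" using False by (simp add: c_def)
    define q where "q = scale c r"
    have qu: "ip q u = 0" if "u \<in> span B" for u
      using ip_expansion_residual[OF B(1) that, of a] by (simp add: q_def r_def ip_scale_left)
    have uq: "ip u q = 0" if "u \<in> span B" for u
      using qu[OF that] ip_commute[of u q] by simp
    have "hnorm q = 1" using False by (simp add: q_def hnorm_scale c_def norm_inverse hnorm_nonneg)
    then have qq: "ip q q = 1" by (simp add: ip_self)
    have on: "orthonormal (insert q B)"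
      using B(1) qu[OF span_base] uq[OF span_base] qq unfolding orthonormal_def by auto
    have "q \<in> span (insert a B)"
      unfolding q_def r_def
      by (meson e insertI1 span_base span_diff span_mono span_scale subset_insertI subsetD)
    moreover have "a \<in> span (insert q B)"
    proof -
      have "a = scale (inverse c) q + expansion B a" using c0 by (simp add: q_def r_def)
      moreover have "scale (inverse c) q + expansion B a \<in> span (insert q B)"
        by (meson e insertI1 span_base span_add span_mono span_scale subset_insertI subsetD)
      ultimately show ?thesis by simp
    qed
    ultimately have "span (insert q B) = span (insert a B)"
      by (auto simp: span_eq intro: span_base)
    with on span_a show ?thesis by auto
  qed
qed

text \<open>A maximal independent subset of \<open>U\<close> spans \<open>U\<close> and is finite,
  being no larger than a basis of the space; Gram-Schmidt then applies.\<close>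

lemma ex_orthonormal_subspace:
  assumes "subspace U"
  shows "\<exists>B. orthonormal B \<and> span B = U"
proof -
  obtain E where E: "finite E" "independent E" "span E = UNIV" using dimension by blast
  obtain C where C: "C \<subseteq> U" "independent C" "U \<subseteq> span C"
    by (rule maximal_independent_subset)
  have "finite C" using independent_span_bound[OF E(1) C(2)] E(3) by auto
  moreover have "span C = U" using span_subspace[OF C(1,3) assms] .
  ultimately show ?thesis using ex_orthonormal_span by blast
qed

text \<open>Resolves the definite description in \<open>proj\<close>: two candidates differ by a
  vector of \<open>U\<close> orthogonal to \<open>U\<close>, hence to itself.\<close>

lemma proj_eqI:
  assumes "subspace U" and "p \<in> U" and "\<And>u. u \<in> U \<Longrightarrow> ip (f - p) u = 0"
  shows "proj U f = p"
  unfolding proj_def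
proof (rule the_equality)
  show "p \<in> U \<and> (\<forall>u\<in>U. ip (f - p) u = 0)" using assms by blast
next
  fix q assume q: "q \<in> U \<and> (\<forall>u\<in>U. ip (f - q) u = 0)"
  then have "p - q \<in> U" using assms by (simp add: subspace_diff)
  then have "ip (f - q) (p - q) - ip (f - p) (p - q) = 0" using q assms by simp
  then have "ip (p - q) (p - q) = 0" by (simp add: ip_diff_left[symmetric])
  then show "q = p" by simp
qed

text \<open>Existence of the projection: the expansion in an orthonormal basis of \<open>U\<close>
  meets both conditions.\<close>

lemma proj_in: "subspace U \<Longrightarrow> proj U f \<in> U"
  and ip_proj_residual: "subspace U \<Longrightarrow> u \<in> U \<Longrightarrow> ip (f - proj U f) u = 0"
proof -
  assume U: "subspace U"
  then obtain B where B: "orthonormal B" "span B = U" using ex_orthonormal_subspace by blast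
  have p: "proj U f = expansion B f"
    by (rule proj_eqI) (use U B expansion_in_span ip_expansion_residual in auto)
  show "proj U f \<in> U" using B expansion_in_span by (auto simp: p)
  show "ip (f - proj U f) u = 0" if "u \<in> U" using that B ip_expansion_residual by (auto simp: p)
qed

lemma proj_add: "subspace U \<Longrightarrow> proj U (f + g) = proj U f + proj U g"
  using ip_proj_residual[of U _ f] ip_proj_residual[of U _ g]
  by (intro proj_eqI) (auto simp: proj_in subspace_add ip_diff_left ip_add_left)

lemma proj_scale: "subspace U \<Longrightarrow> proj U (scale a f) = scale a (proj U f)"
  using ip_proj_residual[of U _ f]
  by (intro proj_eqI) (auto simp: proj_in subspace_scale ip_diff_left ip_scale_left)

text \<open>The residual is orthogonal to \<open>proj U f\<close>, so \<open>f\<close> may be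
  replaced by \<open>proj U f\<close> in the pairing.\<close>

lemma ip_proj_self:
  assumes "subspace U"
  shows "ip (proj U f) f = of_real ((hnorm (proj U f))\<^sup>2)"
proof -
  have "ip f (proj U f) = ip (proj U f) (proj U f)"
    using ip_proj_residual[OF assms proj_in[OF assms], of f] by (simp add: ip_diff_left)
  then have "ip (proj U f) f = sc_cnj (ip (proj U f) (proj U f))"
    using ip_commute[of "proj U f" f] by simp
  then show ?thesis by (simp only: ip_self sc_cnj_of_real)
qed

subsection \<open>Operators of rank at most two\<close>

definition outer :: "'v \<Rightarrow> 'v \<Rightarrow> 'v" where
  "outer f z = scale (ip z f) f"

text \<open>Rescaling a vector only multiplies its \<open>outer\<close> by a nonnegative real, so
  the coefficients have to carry the signs.\<close>

definition rank2 :: "real \<Rightarrow> 'v \<Rightarrow> real \<Rightarrow> 'v \<Rightarrow> 'v \<Rightarrow> 'v" where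
  "rank2 a f b g = (\<lambda>z. scale (of_real a) (outer f z) + scale (of_real b) (outer g z))"

text \<open>By Parseval the summand of \<open>f\<close> contributes \<open>ip (proj U f) f\<close>,
  which is the squared norm of the projection; likewise for \<open>g\<close>.\<close>

lemma trace_proj_rank2:
  assumes U: "subspace U"
  shows "trace (proj U \<circ> rank2 a f b g) =
    of_real (a * (hnorm (proj U f))\<^sup>2 + b * (hnorm (proj U g))\<^sup>2)"
proof -
  \<comment> \<open>This has to be the very basis selected inside \<open>trace\<close>.\<close>
  define B where "B = (SOME B. orthonormal_basis B)"
  have "\<exists>B. orthonormal_basis B"
    using ex_orthonormal_subspace[OF subspace_UNIV]
    by (auto simp: orthonormal_basis_def orthonormal_def)
  then have "orthonormal_basis B" unfolding B_def by (rule someI_ex)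
  then have B: "orthonormal B" "span B = UNIV"
    by (auto simp: orthonormal_basis_def orthonormal_def)
  \<comment> \<open>The orthonormal expansion of \<open>x\<close>, paired with
    \<open>y\<close>.\<close>
  have parseval: "(\<Sum>b\<in>B. ip b y * ip x b) = ip x y" for x y
    using arg_cong[OF expansion_eq[OF B(1), of x], of "\<lambda>z. ip z y"] B(2)
    by (simp add: expansion_def ip_sum_left ip_scale_left mult.commute)
  have "trace (proj U \<circ> rank2 a f b g) = (\<Sum>b'\<in>B. ip (proj U (rank2 a f b g b')) b')"
    by (simp add: trace_def B_def)
  also have "\<dots> = of_real a * (\<Sum>b'\<in>B. ip b' f * ip (proj U f) b')
      + of_real b * (\<Sum>b'\<in>B. ip b' g * ip (proj U g) b')"
    using U by (simp add: rank2_def outer_def proj_add proj_scale ip_add_left ip_scale_left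
        sum.distrib sum_distrib_left mult.assoc)
  finally show ?thesis using U by (simp add: parseval ip_proj_self)
qed

lemma ip_outer: "ip (outer f x) y = ip x (outer f y)"
  by (simp add: outer_def ip_scale_left ip_scale_right flip: ip_commute)

lemma SymI:
  assumes "\<And>x y. T (x + y) = T x + T y" and "\<And>a x. T (scale a x) = scale a (T x)"
    and "\<And>x y. ip (T x) y = ip x (T y)"
  shows "T \<in> Sym"
proof -
  have "Vector_Spaces.linear scale scale T" by unfold_locales (fact assms)+
  then show ?thesis by (simp add: Sym_def assms(3))
qed

lemma SymD:
  assumes "T \<in> Sym"
  shows "T (x + y) = T x + T y" and "T (scale a x) = scale a (T x)"
    and "ip (T x) y = ip x (T y)"
proof -
  interpret T: Vector_Spaces.linear scale scale T using assms by (simp add: Sym_def)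
  show "T (x + y) = T x + T y" "T (scale a x) = scale a (T x)" by (fact T.add T.scale)+
  show "ip (T x) y = ip x (T y)" using assms by (simp add: Sym_def)
qed

lemma outer_add: "outer f (x + y) = outer f x + outer f y"
  by (simp add: outer_def ip_add_left scale_left_distrib)

lemma outer_scale: "outer f (scale a x) = scale a (outer f x)"
  by (simp add: outer_def ip_scale_left)

lemma Sym_add_scaled_outer:
  assumes "T \<in> Sym"
  shows "(\<lambda>z. T z + scale (of_real a) (outer f z)) \<in> Sym"
  by (rule SymI)
    (simp_all add: SymD[OF assms] outer_add outer_scale ip_add_left ip_add_right
      ip_scale_left ip_scale_right ip_outer scale_right_distrib mult.commute)

lemma zero_Sym: "(\<lambda>z. 0) \<in> Sym"
  by (rule SymI) simp_all

lemma rank2_Sym: "rank2 a f b g \<in> Sym"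
  using Sym_add_scaled_outer[OF Sym_add_scaled_outer[OF zero_Sym, of a f], of b g]
  by (simp add: rank2_def)

lemma rank2_S11: "rank2 a f b g \<in> S11"
proof -
  have "rank2 a f b g z \<in> span {f, g}" for z
    unfolding rank2_def outer_def by (intro span_add span_scale span_base) auto
  then have "dim (range (rank2 a f b g)) \<le> card {f, g}" by (intro dim_le_card) auto
  also have "\<dots> \<le> 2" by (simp add: card_insert_if)
  finally show ?thesis by (simp add: S11_def rank2_Sym)
qed

text \<open>The form at \<open>z + T z\<close> leaves two cross terms, and self-adjointness makes
  both equal to the squared norm of \<open>T z\<close>. This covers real and complex scalars at
  once.\<close>

lemma Sym_eq_0I:
  assumes "T \<in> Sym" and q: "\<And>x. ip (T x) x = 0"
  shows "T z = 0"
proof -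
  have "ip (T (z + T z)) (z + T z) = ip (T z) (T z) + ip (T (T z)) z"
    using q by (simp add: SymD(1)[OF assms(1)] ip_add_left ip_add_right)
  also have "ip (T (T z)) z = ip (T z) (T z)" by (rule SymD(3)[OF assms(1)])
  finally have "2 * ip (T z) (T z) = 0" using q by simp
  then show ?thesis by simp
qed

text \<open>The corrected operator \<open>T'\<close> kills \<open>x\<close>, so its range is
  orthogonal to \<open>x\<close>, whereas \<open>T x\<close> is not. Hence the range shrinks
  strictly and the dimension drops.\<close>

lemma Sym_deflate:
  assumes T: "T \<in> Sym" and d: "dim (range T) \<le> Suc k"
  shows "\<exists>T' a f. T' \<in> Sym \<and> dim (range T') \<le> k \<and>
    T = (\<lambda>z. T' z + scale (of_real a) (outer f z))"
proof (cases "\<exists>x. ip (T x) x \<noteq> 0")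
  \<comment> \<open>A vanishing quadratic form means \<open>T = 0\<close>, which splits
    trivially.\<close>
  case False
  then have T0: "T z = 0" for z using Sym_eq_0I[OF T] by blast
  have "dim {0} = 0" using dim_le_card[of "{0}" "{}"] by simp
  then have "dim (range (\<lambda>z::'v. 0::'v)) \<le> k" by simp
  moreover have "T = (\<lambda>z. 0 + scale (of_real 0) (outer 0 z))" using T0 by auto
  ultimately show ?thesis using zero_Sym by blast
next
  case True
  then obtain x where x: "ip (T x) x \<noteq> 0" by blast
  define c where "c = sc_re (ip (T x) x)"
  have c: "ip (T x) x = of_real c"
    unfolding c_def by (metis SymD(3)[OF T] ip_commute sc_cnj_fixed)
  have c': "ip x (T x) = of_real c" using c SymD(3)[OF T, of x x] by simp
  have c0: "c \<noteq> 0" using x c by auto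
  \<comment> \<open>The coefficient is the one for which \<open>T' x = 0\<close>.\<close>
  define T' where "T' = (\<lambda>z. T z + scale (of_real (- inverse c)) (outer (T x) z))"
  have T': "T' \<in> Sym" unfolding T'_def by (rule Sym_add_scaled_outer[OF T])
  have "T' x = 0" using c0 by (simp add: T'_def outer_def c')
  then have orth: "ip (T' z) x = 0" for z using SymD(3)[OF T', of z x] by simp
  interpret T: Vector_Spaces.linear scale scale T using T by (simp add: Sym_def)
  interpret T': Vector_Spaces.linear scale scale T' using T' by (simp add: Sym_def)
  have sT: "subspace (range T)" by (intro T.subspace_image subspace_UNIV)
  have sT': "subspace (range T')" by (intro T'.subspace_image subspace_UNIV)
  have "T' z \<in> range T" for z
    unfolding T'_def outer_def by (intro subspace_add[OF sT] subspace_scale[OF sT] rangeI)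
  moreover have "T x \<notin> range T'" using orth x by auto
  ultimately have psub: "range T' \<subset> range T" by blast
  obtain E where "finite E" "independent E" "span E = UNIV" using dimension by blast
  then interpret F: finite_dimensional_vector_space scale E by unfold_locales
  have "dim (range T') < dim (range T)"
    \<comment> \<open>The dimension comparison is between spans; both ranges are subspaces, hence
      their own spans.\<close>
    using psub sT sT' by (intro F.dim_psubset) (simp add: span_eq_iff[THEN iffD2])
  then have "dim (range T') \<le> k" using d by simp
  moreover have "T = (\<lambda>z. T' z + scale (of_real (inverse c)) (outer (T x) z))"
    by (simp add: T'_def)
  ultimately show ?thesis using T' by blast
qed

text \<open>Two deflations leave an operator of rank zero.\<close>

lemma S11_rank2:
  assumes "T \<in> S11"
  obtains a f b g where "T = rank2 a f b g"
proof -
  have T: "T \<in> Sym" "dim (range T) \<le> Suc (Suc 0)" using assms by (simp_all add: S11_def)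
  obtain T' a f where 1: "T' \<in> Sym" "dim (range T') \<le> Suc 0"
    "T = (\<lambda>z. T' z + scale (of_real a) (outer f z))" using Sym_deflate[OF T] by blast
  obtain T'' b g where 2: "T'' \<in> Sym" "dim (range T'') \<le> 0"
    "T' = (\<lambda>z. T'' z + scale (of_real b) (outer g z))" using Sym_deflate[OF 1(1,2)] by blast
  obtain E where "finite E" "independent E" "span E = UNIV" using dimension by blast
  then interpret F: finite_dimensional_vector_space scale E by unfold_locales
  have "range T'' \<subseteq> {0}" using 2(2) F.dim_eq_0 by simp
  then have "T'' z = 0" for z by auto
  then have "T = rank2 b g a f" using 1(3) 2(3) by (auto simp: rank2_def)
  then show ?thesis by (rule that)
qed

section \<open>A vector is determined by its rank-one operator up to phase\<close>

lemma outer_eq_imp_phase: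
  assumes "\<And>z. outer f z = outer g z"
  shows "\<exists>h. norm h = 1 \<and> g = scale h f"
proof (cases "f = 0")
  case True
  then have "outer g g = 0" using assms[of g] by (simp add: outer_def)
  then have "g = 0" by (auto simp: outer_def)
  with True show ?thesis by (intro exI[of _ 1]) simp
next
  case False
  \<comment> \<open>Evaluating both operators at \<open>f\<close> makes \<open>f\<close> and
    \<open>g\<close> proportional and excludes \<open>ip f g = 0\<close>.\<close>
  have e: "scale (ip f f) f = scale (ip f g) g" using assms[of f] by (simp add: outer_def)
  with False have nz: "ip f g \<noteq> 0" by auto
  define h where "h = ip f f / ip f g"
  have g: "g = scale h f"
  proof -
    have "scale h f = scale (inverse (ip f g)) (scale (ip f f) f)"
      by (simp add: h_def divide_inverse mult.commute)
    also have "\<dots> = g" using nz by (simp add: e)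
    finally show ?thesis by simp
  qed
  \<comment> \<open>Computing \<open>ip f f\<close> through \<open>g = scale h f\<close> reproduces
    it with the factor \<open>h * sc_cnj h\<close>, which is therefore 1.\<close>
  have "ip f f = h * ip f g" using nz by (simp add: h_def)
  also have "ip f g = sc_cnj h * ip f f" by (subst g) (rule ip_scale_right)
  also have "h * (sc_cnj h * ip f f) = of_real ((norm h)\<^sup>2) * ip f f"
    by (simp only: mult.assoc[symmetric] mult_sc_cnj)
  finally have "(of_real ((norm h)\<^sup>2) :: 'k) = of_real 1"
    using False by (simp del: of_real_power)
  then have "(norm h)\<^sup>2 = 1" by (simp only: of_real_eq_iff)
  then have "norm h = 1" by (simp add: power2_eq_1_iff) (use norm_ge_zero[of h] in linarith)
  with g show ?thesis by blast
qed

lemma outer_phase: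
  assumes "norm h = 1"
  shows "outer (scale h f) = outer f"
proof
  fix z
  have "sc_cnj h * h = 1" using mult_sc_cnj[of h] assms by (simp add: mult.commute)
  then show "outer (scale h f) z = outer f z"
    by (simp add: outer_def ip_scale_right mult.commute mult.left_commute)
qed

subsection \<open>Measurements\<close>

text \<open>Coordinate \<open>i\<close> of the measurement on a representative, before passing to
  phase classes.\<close>

definition meas ::
  "(nat \<Rightarrow> 'v set) \<Rightarrow> (nat \<Rightarrow> real) \<Rightarrow> (nat \<Rightarrow> 'v set) \<Rightarrow> (nat \<Rightarrow> real) \<Rightarrow> nat set
     \<Rightarrow> nat \<Rightarrow> 'v \<Rightarrow> real" where
  "meas V v W w \<sigma> i f =
     (if i \<in> \<sigma> then v i * hnorm (proj (V i) f) else w i * hnorm (proj (W i) f))"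

lemma equiv_phase_rel: "equiv UNIV phase_rel"
proof (rule equivI)
  show "refl phase_rel"
    by (rule refl_onI) (auto simp: phase_rel_def intro!: exI[of _ "1::'k"])
  show "sym phase_rel"
  proof (rule symI)
    fix f g assume "(f, g) \<in> phase_rel"
    then obtain h where h: "norm h = 1" "g = scale h f" by (auto simp: phase_rel_def)
    then have "h \<noteq> 0" by auto
    with h show "(g, f) \<in> phase_rel"
      by (auto simp: phase_rel_def norm_inverse intro!: exI[of _ "inverse h"])
  qed
  show "trans phase_rel"
  proof (rule transI)
    fix x y z assume "(x, y) \<in> phase_rel" "(y, z) \<in> phase_rel"
    then obtain h k where "norm h = 1" "y = scale h x" "norm k = 1" "z = scale k y"
      by (auto simp: phase_rel_def)
    then show "(x, z) \<in> phase_rel"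
      by (auto simp: phase_rel_def norm_mult intro!: exI[of _ "k * h"])
  qed
qed simp

text \<open>A unit scalar passes through the projection and leaves the norm unchanged, so the image
  of a class is a singleton and \<open>the_elem\<close> returns its value.\<close>

lemma weaving_measurement_class:
  assumes "\<forall>i\<in>{1..m}. subspace (V i)" and "\<forall>i\<in>{1..m}. subspace (W i)"
  shows "weaving_measurement m V v W w \<sigma> (phase_rel `` {f}) = (\<lambda>i\<in>{1..m}. meas V v W w \<sigma> i f)"
  unfolding weaving_measurement_def
proof (rule restrict_ext)
  fix i assume i: "i \<in> {1..m}"
  have "meas V v W w \<sigma> i g = meas V v W w \<sigma> i f" if "g \<in> phase_rel `` {f}" for g
    using that i assms by (auto simp: phase_rel_def meas_def proj_scale hnorm_scale)
  moreover have "f \<in> phase_rel `` {f}"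
    using equiv_phase_rel by (rule equiv_class_self) simp
  ultimately have "meas V v W w \<sigma> i ` (phase_rel `` {f}) = {meas V v W w \<sigma> i f}" by blast
  moreover have "(\<lambda>f. if i \<in> \<sigma> then v i * hnorm (proj (V i) f)
      else w i * hnorm (proj (W i) f)) = meas V v W w \<sigma> i"
    by (simp add: meas_def fun_eq_iff)
  ultimately show "the_elem ((\<lambda>f. if i \<in> \<sigma> then v i * hnorm (proj (V i) f)
      else w i * hnorm (proj (W i) f)) ` (phase_rel `` {f})) = meas V v W w \<sigma> i f"
    by (simp only: the_elem_eq)
qed

text \<open>Moves injectivity from the quotient to representatives.\<close>

lemma inj_on_weaving_measurement_iff:
  assumes "\<forall>i\<in>{1..m}. subspace (V i)" and "\<forall>i\<in>{1..m}. subspace (W i)"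
  shows "inj_on (weaving_measurement m V v W w \<sigma>) phase_space \<longleftrightarrow>
    (\<forall>f g. (\<forall>i\<in>{1..m}. meas V v W w \<sigma> i f = meas V v W w \<sigma> i g) \<longrightarrow> (f, g) \<in> phase_rel)"
proof -
  have eq: "phase_rel `` {f} = phase_rel `` {g} \<longleftrightarrow> (f, g) \<in> phase_rel" for f g
    using eq_equiv_class_iff[OF equiv_phase_rel] by simp
  have "(\<lambda>i\<in>{1..m}. meas V v W w \<sigma> i f) = (\<lambda>i\<in>{1..m}. meas V v W w \<sigma> i g) \<longleftrightarrow>
      (\<forall>i\<in>{1..m}. meas V v W w \<sigma> i f = meas V v W w \<sigma> i g)" for f g
    by (auto simp: restrict_def fun_eq_iff)
  then have "inj_on (weaving_measurement m V v W w \<sigma>) ((\<lambda>f. phase_rel `` {f}) ` UNIV) \<longleftrightarrow>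
    (\<forall>f g. (\<forall>i\<in>{1..m}. meas V v W w \<sigma> i f = meas V v W w \<sigma> i g) \<longrightarrow> (f, g) \<in> phase_rel)"
    by (simp add: inj_on_def weaving_measurement_class[OF assms] eq)
  moreover have "phase_space = (\<lambda>f. phase_rel `` {f}) ` UNIV"
    by (auto simp: phase_space_def quotient_def)
  ultimately show ?thesis by simp
qed

section \<open>Phase lift and frame sums in terms of measurements\<close>

lemma phase_lift_rank2:
  assumes "\<forall>i\<in>{1..m}. subspace (V i)" and "\<forall>i\<in>{1..m}. subspace (W i)"
  shows "phase_lift m V v W w \<sigma> (rank2 a f b g) =
    (\<lambda>i\<in>{1..m}. a * (meas V v W w \<sigma> i f)\<^sup>2 + b * (meas V v W w \<sigma> i g)\<^sup>2)"
  unfolding phase_lift_def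
  \<comment> \<open>Keeping \<open>of_real\<close> around the whole sum lets \<open>sc_re\<close>
    cancel it.\<close>
  by (rule restrict_ext)
    (use assms in \<open>simp add: trace_proj_rank2 meas_def power_mult_distrib algebra_simps
      del: of_real_add of_real_mult of_real_power\<close>)

lemma rank2_in_phase_lift_ker_iff:
  assumes "\<forall>i\<in>{1..m}. subspace (V i)" and "\<forall>i\<in>{1..m}. subspace (W i)"
  shows "rank2 a f b g \<in> phase_lift_ker m V v W w \<sigma> \<longleftrightarrow>
    (\<forall>i\<in>{1..m}. a * (meas V v W w \<sigma> i f)\<^sup>2 + b * (meas V v W w \<sigma> i g)\<^sup>2 = 0)"
  by (auto simp: phase_lift_ker_def rank2_Sym phase_lift_rank2[OF assms] restrict_def fun_eq_iff)

lemma weaving_sum_eq: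
  assumes "\<sigma> \<subseteq> {1..m}"
  shows "weaving_sum m V v W w \<sigma> f = (\<Sum>i\<in>{1..m}. (meas V v W w \<sigma> i f)\<^sup>2)"
proof -
  have "(\<Sum>i\<in>{1..m}. (meas V v W w \<sigma> i f)\<^sup>2) =
      (\<Sum>i\<in>{1..m} - \<sigma>. (meas V v W w \<sigma> i f)\<^sup>2) + (\<Sum>i\<in>\<sigma>. (meas V v W w \<sigma> i f)\<^sup>2)"
    by (rule sum.subset_diff[OF assms]) simp
  then show ?thesis by (simp add: weaving_sum_def meas_def power_mult_distrib)
qed

lemma meas_scale:
  assumes "\<forall>i\<in>{1..m}. subspace (V i)" and "\<forall>i\<in>{1..m}. subspace (W i)" and "i \<in> {1..m}"
  shows "meas V v W w \<sigma> i (scale a f) = norm a * meas V v W w \<sigma> i f"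
  using assms by (simp add: meas_def proj_scale hnorm_scale)

text \<open>Weights may be negative, but both sides share the same weight: either it is zero or the
  nonnegative norms agree.\<close>

lemma meas_sq_eq_imp_eq:
  assumes "(meas V v W w \<sigma> i f)\<^sup>2 = (meas V v W w \<sigma> i g)\<^sup>2"
  shows "meas V v W w \<sigma> i f = meas V v W w \<sigma> i g"
  using assms hnorm_nonneg
  by (auto simp: meas_def power_mult_distrib split: if_splits)

text \<open>This case arises because \<open>S11\<close> restricts only the rank and not the signature.\<close>

lemma semidefinite_rank2_in_ker_eq_0:
  assumes sub: "\<forall>i\<in>{1..m}. subspace (V i)" "\<forall>i\<in>{1..m}. subspace (W i)"
    and A: "0 < A" "\<And>f. A * (hnorm f)\<^sup>2 \<le> weaving_sum m V v W w \<sigma> f"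
    and \<sigma>: "\<sigma> \<subseteq> {1..m}"
    and sgn: "a \<ge> 0 \<and> b \<ge> 0 \<or> a \<le> 0 \<and> b \<le> 0"
    and ker: "rank2 a f b g \<in> phase_lift_ker m V v W w \<sigma>"
  shows "rank2 a f b g = (\<lambda>x. 0)"
proof -
  let ?S = "weaving_sum m V v W w \<sigma>"
  have pos: "0 \<le> ?S h" for h by (simp add: weaving_sum_eq[OF \<sigma>] sum_nonneg)
  \<comment> \<open>The positive lower bound \<open>A\<close> makes the weaving sum
    definite.\<close>
  have zero: "h = 0" if "?S h = 0" for h
    using A(2)[of h] A(1) that by (simp add: mult_le_0_iff)
  have "a * ?S f + b * ?S g =
      (\<Sum>i\<in>{1..m}. a * (meas V v W w \<sigma> i f)\<^sup>2 + b * (meas V v W w \<sigma> i g)\<^sup>2)"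
    by (simp add: weaving_sum_eq[OF \<sigma>] sum.distrib sum_distrib_left)
  also have "\<dots> = 0" using ker by (intro sum.neutral) (simp add: rank2_in_phase_lift_ker_iff[OF sub])
  finally have s: "a * ?S f + b * ?S g = 0" .
  \<comment> \<open>Two terms of the same sign that add up to zero both vanish.\<close>
  have "a * ?S f = 0 \<and> b * ?S g = 0"
    using sgn
  proof
    assume "a \<ge> 0 \<and> b \<ge> 0"
    with s pos show ?thesis by (simp add: add_nonneg_eq_0_iff)
  next
    assume "a \<le> 0 \<and> b \<le> 0"
    with s pos show ?thesis by (simp add: add_nonpos_eq_0_iff mult_nonpos_nonneg)
  qed
  then have "a = 0 \<or> f = 0" "b = 0 \<or> g = 0" using zero by auto
  then show ?thesis by (auto simp: rank2_def outer_def)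
qed

lemma indefinite_rank2_in_ker_eq_0:
  assumes sub: "\<forall>i\<in>{1..m}. subspace (V i)" "\<forall>i\<in>{1..m}. subspace (W i)"
    and inj: "inj_on (weaving_measurement m V v W w \<sigma>) phase_space"
    and sgn: "a \<ge> 0" "b \<le> 0"
    and ker: "rank2 a f b g \<in> phase_lift_ker m V v W w \<sigma>"
  shows "rank2 a f b g = (\<lambda>x. 0)"
proof -
  \<comment> \<open>Absorbing the square roots gives \<open>rank2 a f b g\<close> the form
    \<open>outer f'\<close> minus \<open>outer g'\<close>, so the kernel condition equates squared
    measurements.\<close>
  define f' g' where "f' = scale (of_real (sqrt a)) f" and "g' = scale (of_real (sqrt (- b))) g"
  have "meas V v W w \<sigma> i f' = meas V v W w \<sigma> i g'" if i: "i \<in> {1..m}" for i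
  proof (rule meas_sq_eq_imp_eq)
    have "a * (meas V v W w \<sigma> i f)\<^sup>2 + b * (meas V v W w \<sigma> i g)\<^sup>2 = 0"
      using ker i by (simp add: rank2_in_phase_lift_ker_iff[OF sub])
    then show "(meas V v W w \<sigma> i f')\<^sup>2 = (meas V v W w \<sigma> i g')\<^sup>2"
      using sgn by (simp add: f'_def g'_def meas_scale[OF sub i] power_mult_distrib)
  qed
  then have "(f', g') \<in> phase_rel" using inj inj_on_weaving_measurement_iff[OF sub] by blast
  then obtain h where "norm h = 1" "g' = scale h f'" by (auto simp: phase_rel_def)
  then have eq: "outer g' = outer f'" by (simp add: outer_phase)
  have outer_scaled: "outer (scale (of_real (sqrt c)) x) z = scale (of_real c) (outer x z)"
    if "c \<ge> 0" for c x z
  proof -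
    have "(of_real (sqrt c) * of_real (sqrt c) :: 'k) = of_real c"
      using that by (simp flip: of_real_mult)
    then show ?thesis
      by (simp add: outer_def ip_scale_right mult.commute mult.left_commute)
  qed
  have "outer f' z = scale (of_real a) (outer f z)" "outer g' z = scale (of_real (- b)) (outer g z)"
    for z using sgn outer_scaled by (simp_all add: f'_def g'_def del: of_real_minus)
  then show ?thesis using eq by (auto simp: rank2_def fun_eq_iff)
qed

text \<open>The equivalence holds for each \<sigma> separately; the weaving hypothesis supplies the
  lower bound.\<close>

lemma phase_retrievable_weaving_iff:
  assumes weav: "weaving_fusion_frames m V v W w"
  shows "phase_retrievable_weaving m V v W w \<longleftrightarrow>
    (\<forall>\<sigma>. \<sigma> \<subseteq> {1..m} \<longrightarrow> phase_lift_ker m V v W w \<sigma> \<inter> S11 = {\<lambda>x. 0})"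
proof -
  have sub: "\<forall>i\<in>{1..m}. subspace (V i)" "\<forall>i\<in>{1..m}. subspace (W i)"
    using weav by (auto simp: weaving_fusion_frames_def fusion_frame_def)
  obtain A where A: "0 < A"
    "\<And>\<sigma> f. \<sigma> \<subseteq> {1..m} \<Longrightarrow> A * (hnorm f)\<^sup>2 \<le> weaving_sum m V v W w \<sigma> f"
    using weav unfolding weaving_fusion_frames_def by blast
  have "inj_on (weaving_measurement m V v W w \<sigma>) phase_space \<longleftrightarrow>
    phase_lift_ker m V v W w \<sigma> \<inter> S11 = {\<lambda>x. 0}" if \<sigma>: "\<sigma> \<subseteq> {1..m}" for \<sigma>
  proof
    assume inj: "inj_on (weaving_measurement m V v W w \<sigma>) phase_space"
    have swap: "rank2 a f b g = rank2 b g a f" for a f b g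
      by (simp add: rank2_def add.commute)
    have "T = (\<lambda>x. 0)" if "T \<in> phase_lift_ker m V v W w \<sigma>" "T \<in> S11" for T
    proof -
      obtain a f b g where T: "T = rank2 a f b g" using S11_rank2[OF \<open>T \<in> S11\<close>] .
      \<comment> \<open>Equal signs use the frame bound, opposite signs use injectivity; the last
        case is the second with the summands swapped.\<close>
      consider "a \<ge> 0 \<and> b \<ge> 0 \<or> a \<le> 0 \<and> b \<le> 0" | "a \<ge> 0" "b \<le> 0" | "b \<ge> 0" "a \<le> 0"
        by linarith
      then show ?thesis
      proof cases
        case 1
        with that(1) A \<sigma> show ?thesis unfolding T
          by (intro semidefinite_rank2_in_ker_eq_0[OF sub]) auto
      next
        case 2
        with that(1) show ?thesis unfolding T
          by (intro indefinite_rank2_in_ker_eq_0[OF sub inj])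
      next
        case 3
        with that(1) show ?thesis unfolding T swap[of a f b g]
          by (intro indefinite_rank2_in_ker_eq_0[OF sub inj])
      qed
    qed
    moreover have "(\<lambda>x. 0) = rank2 0 0 0 0" by (simp add: rank2_def)
    then have "(\<lambda>x. 0) \<in> phase_lift_ker m V v W w \<sigma> \<inter> S11"
      by (simp add: rank2_S11 rank2_in_phase_lift_ker_iff[OF sub])
    ultimately show "phase_lift_ker m V v W w \<sigma> \<inter> S11 = {\<lambda>x. 0}" by blast
  next
    assume ker: "phase_lift_ker m V v W w \<sigma> \<inter> S11 = {\<lambda>x. 0}"
    have "(f, g) \<in> phase_rel"
      if "\<forall>i\<in>{1..m}. meas V v W w \<sigma> i f = meas V v W w \<sigma> i g" for f g
    proof -
      \<comment> \<open>Equal measurements put the difference of the two rank-one operators into the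
        kernel.\<close>
      have "rank2 1 f (- 1) g \<in> phase_lift_ker m V v W w \<sigma>"
        using that by (simp add: rank2_in_phase_lift_ker_iff[OF sub])
      then have "rank2 1 f (- 1) g = (\<lambda>x. 0)" using ker rank2_S11 by blast
      then have "outer f z = outer g z" for z by (simp add: rank2_def fun_eq_iff)
      then show ?thesis using outer_eq_imp_phase by (auto simp: phase_rel_def)
    qed
    then show "inj_on (weaving_measurement m V v W w \<sigma>) phase_space"
      unfolding inj_on_weaving_measurement_iff[OF sub] by blast
  qed
  then show ?thesis using weav by (auto simp: phase_retrievable_weaving_def)
qed

end

theorem theorem3p4:
  fixes scale :: "'k::real_or_complex \<Rightarrow> 'v::ab_group_add \<Rightarrow> 'v"
    and ip :: "'v \<Rightarrow> 'v \<Rightarrow> 'k"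
    and n m :: nat
    and V W :: "nat \<Rightarrow> 'v set"
    and v w :: "nat \<Rightarrow> real"
  assumes "fd_hilbert_space scale ip n"
    and "fd_hilbert_space.weaving_fusion_frames scale ip m V v W w"
  shows "fd_hilbert_space.phase_retrievable_weaving scale ip m V v W w \<longleftrightarrow>
    (\<forall>\<sigma>. \<sigma> \<subseteq> {1..m} \<longrightarrow>
      fd_hilbert_space.phase_lift_ker scale ip m V v W w \<sigma> \<inter> fd_hilbert_space.S11 scale ip
        = {\<lambda>x. 0})"
  using assms by (rule fd_hilbert_space.phase_retrievable_weaving_iff)

end
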